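(* Let $\mathcal{V}$ be a separable Hilbert space, let $f:\mathcal{V}\to[0,\infty]$ be weakly lower semi-continuous, and let $x_0\in\mathcal{V}$. Then either $f(x_0)=\mathcal{S}^2(f)(x_0)$, or there exist a unit vector $\nu\in\mathcal{V}$ and $t_0>0$ such that the function $h(t)=\mathcal{S}^2(f)(x_0+t\nu)$ has second derivative $-1$ on $(-t_0,t_0)$.
   Context: $\mathcal{V}$ is a separable Hilbert space over $\mathbb{R}$ or $\mathbb{C}$ (possibly finite dimensional); in the complex case it is regarded as a real Hilbert space with scalar product $\mathrm{Re}\langle x,y\rangle$. For an extended-real-valued functional $g$ on $\mathcal{V}$ define $\mathcal{S}(g)(y)=\sup_{x\in\mathcal{V}}\left(-g(x)-\frac12\|x-y\|^2\right)$, and $\mathcal{S}^2=\mathcal{S}\circ\mathcal{S}$. Weakly lower semi-continuous means lower semi-continuous with respect to the weak topology of $\mathcal{V}$. *)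

theory Defs
  imports "HOL-Analysis.Analysis"
begin

text \<open>The coarsest topology for which every continuous linear functional is continuous.\<close>

definition weak_topology :: "'a::real_normed_vector topology" where
  "weak_topology =
     topology_generated_by {\<phi> -` U | (\<phi> :: 'a \<Rightarrow> real) U. bounded_linear \<phi> \<and> open U}"

definition lower_semicontinuous_map :: "'a topology \<Rightarrow> ('a \<Rightarrow> ereal) \<Rightarrow> bool" where
  "lower_semicontinuous_map X f \<longleftrightarrow> (\<forall>a. openin X {x \<in> topspace X. a < f x})"

abbreviation weakly_lower_semicontinuous :: "('a::real_normed_vector \<Rightarrow> ereal) \<Rightarrow> bool" where
  "weakly_lower_semicontinuous f \<equiv> lower_semicontinuous_map weak_topology f"

text \<open>The subtracted quadratic term is finite, so no \<open>\<infinity> - \<infinity>\<close> occurs even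
  where \<open>g\<close> takes the values \<open>\<infinity>\<close> or \<open>-\<infinity>\<close>.\<close>

definition S_transform :: "('a::real_normed_vector \<Rightarrow> ereal) \<Rightarrow> 'a \<Rightarrow> ereal" where
  "S_transform g y = (SUP x. - g x - ereal (1 / 2 * (norm (x - y))\<^sup>2))"

end

theory Submission
  imports Defs
begin

text \<open>With \<open>g = f + \<parallel>\<cdot>\<parallel>\<^sup>2 / 2\<close>, the function \<open>G = S\<^sup>2 f + \<parallel>\<cdot>\<parallel>\<^sup>2 / 2\<close> is the closed convex envelope
  of \<open>g\<close>. If the lowest point \<open>p = (x\<^sub>0, G x\<^sub>0)\<close> of the epigraph of \<open>G\<close> is not extreme, it is interior
  to a segment of the epigraph, \<open>G\<close> is affine along it, and subtracting the quadratic gives second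
  derivative \<open>-1\<close>. If it is extreme, then it lies in the weak closure of the epigraph of \<open>g\<close>, as in
  Milman's theorem: for every closed half-space \<open>H\<close> not containing \<open>p\<close>, discarding \<open>H\<close> from the
  epigraph of \<open>g\<close> keeps \<open>p\<close> in the closed convex hull. Since \<open>f\<close> is weakly lower semicontinuous,
  this forces \<open>f x\<^sub>0 = S\<^sup>2 f x\<^sub>0\<close>.\<close>

subsection \<open>Closed convex sets in Hilbert spaces\<close>

lemma infdist_less_imp_dist_less:
  assumes "S \<noteq> {}" "infdist x S < e"
  obtains y where "y \<in> S" "dist x y < e"
  using assms cINF_less_iff[OF assms(1) bdd_below_image_dist, of x e] by (auto simp: infdist_def)

text \<open>The distances from 0 to the \<open>C n\<close> increase to a finite limit, so by the
  parallelogram law points of almost minimal norm form a Cauchy sequence. Completeness thus takes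
  the place of weak compactness.\<close>

lemma nested_closed_convex_Inter_nonempty:
  fixes C :: "nat \<Rightarrow> 'a::{real_inner, complete_space} set"
  assumes closed: "\<And>n. closed (C n)" and convex: "\<And>n. convex (C n)"
    and nonempty: "\<And>n. C n \<noteq> {}" and "decseq C" and "bounded (C 0)"
  obtains z where "\<And>n. z \<in> C n"
proof -
  have subset: "C m \<subseteq> C n" if "n \<le> m" for m n
    using \<open>decseq C\<close> that by (auto simp: decseq_def)
  define d where "d n = infdist 0 (C n)" for n
  obtain B where B: "norm x \<le> B" if "x \<in> C 0" for x
    using \<open>bounded (C 0)\<close> by (auto simp: bounded_iff)
  have d_le: "d n \<le> norm x" if "x \<in> C n" for x n
    using infdist_le[OF that, of 0] by (simp add: d_def)
  have "d n \<le> B" for n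
    using nonempty[of n] d_le B subset[of 0 n] by (meson all_not_in_conv order_trans subsetD le0)
  moreover have "incseq d"
    unfolding d_def incseq_def by (intro allI impI infdist_mono subset nonempty)
  ultimately obtain L where L: "d \<longlonglongrightarrow> L"
    using incseq_convergent by blast
  \<comment> \<open>The vanishing margin allows a choice of points without knowing that the distance
    is attained.\<close>
  define e where "e n = d n + 1 / real (Suc n)" for n
  have "\<exists>z\<in>C n. norm z < e n" for n
  proof -
    have "d n < e n" by (simp add: e_def)
    then show ?thesis
      using infdist_less_imp_dist_less[OF nonempty[of n], of 0 "e n"]
      by (auto simp: d_def)
  qed
  then obtain z where z: "z n \<in> C n" "norm (z n) < e n" for n
    by metis
  have "e \<longlonglongrightarrow> L + 0"
    unfolding e_def by (intro tendsto_add L LIMSEQ_Suc[OF lim_1_over_n])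
  then have e2: "(\<lambda>n. (e n)\<^sup>2) \<longlonglongrightarrow> L\<^sup>2"
    by (auto intro: tendsto_power)
  have d2: "(\<lambda>n. (d n)\<^sup>2) \<longlonglongrightarrow> L\<^sup>2"
    by (intro tendsto_power L)
  \<comment> \<open>The midpoint of \<open>z n\<close> and \<open>z m\<close> lies in
    \<open>C n\<close>, so its norm is at least \<open>d n\<close>; the parallelogram law turns this
    into a bound on the difference.\<close>
  have close: "(norm (z n - z m))\<^sup>2 \<le> 2 * (e n)\<^sup>2 + 2 * (e m)\<^sup>2 - 4 * (d n)\<^sup>2" if "n \<le> m" for m n
  proof -
    have "(1/2) *\<^sub>R z n + (1/2) *\<^sub>R z m \<in> C n"
      using z subset[OF that] by (intro convexD[OF convex]) auto
    from d_le[OF this] have "d n \<le> norm (z n + z m) / 2"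
      by (simp flip: scaleR_add_right)
    then have "(d n)\<^sup>2 \<le> (norm (z n + z m) / 2)\<^sup>2"
      by (intro power_mono) (auto simp: d_def infdist_nonneg)
    moreover have "(norm (z k))\<^sup>2 \<le> (e k)\<^sup>2" for k
      using z(2)[of k] by (intro power_mono) auto
    from this[of n] this[of m]
    have "(norm (z n - z m))\<^sup>2 + (norm (z n + z m))\<^sup>2 \<le> 2 * (e n)\<^sup>2 + 2 * (e m)\<^sup>2"
      by (simp add: power2_norm_eq_inner algebra_simps inner_commute)
    ultimately show ?thesis by (simp add: power_divide)
  qed
  have "Cauchy z"
  proof (rule metric_CauchyI)
    fix \<epsilon> :: real assume "\<epsilon> > 0"
    then have \<delta>: "\<epsilon>\<^sup>2 / 16 > 0" by simp
    obtain N1 where N1: "\<bar>(e n)\<^sup>2 - L\<^sup>2\<bar> < \<epsilon>\<^sup>2 / 16" if "n \<ge> N1" for n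
      using LIMSEQ_D[OF e2 \<delta>] by auto
    obtain N2 where N2: "\<bar>(d n)\<^sup>2 - L\<^sup>2\<bar> < \<epsilon>\<^sup>2 / 16" if "n \<ge> N2" for n
      using LIMSEQ_D[OF d2 \<delta>] by auto
    have *: "dist (z n) (z m) < \<epsilon>" if "n \<ge> max N1 N2" "n \<le> m" for n m
    proof -
      have "(norm (z n - z m))\<^sup>2 < \<epsilon>\<^sup>2"
        using close[OF that(2)] N1[of n] N1[of m] N2[of n] that \<delta> by linarith
      then show ?thesis
        using \<open>\<epsilon> > 0\<close> by (simp add: dist_norm power_less_imp_less_base)
    qed
    show "\<exists>M. \<forall>m\<ge>M. \<forall>n\<ge>M. dist (z m) (z n) < \<epsilon>"
      by (metis * dist_commute nat_le_linear)
  qed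
  then obtain w where w: "z \<longlonglongrightarrow> w"
    using Cauchy_convergent_iff convergent_def by blast
  have "w \<in> C n" for n
  proof (rule Lim_in_closed_set[OF closed _ _ w])
    show "\<forall>\<^sub>F k in sequentially. z k \<in> C n"
      unfolding eventually_sequentially using z(1) subset by blast
  qed auto
  then show thesis by (rule that)
qed

text \<open>This replaces the extraction of a weakly convergent subsequence.\<close>

lemma bounded_sequence_convex_cluster_point:
  fixes x :: "nat \<Rightarrow> 'a::{real_inner, complete_space}"
  assumes "bounded (range x)"
  obtains z where
    "\<And>S. closed S \<Longrightarrow> convex S \<Longrightarrow> eventually (\<lambda>k. x k \<in> S) sequentially \<Longrightarrow> z \<in> S"
proof -
  \<comment> \<open>A closed convex set containing a tail of the sequence contains some
    \<open>C n\<close>, so a point common to all \<open>C n\<close> serves.\<close>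
  define C where "C n = closure (convex hull (x ` {n..}))" for n
  obtain z where z: "z \<in> C n" for n
  proof (rule nested_closed_convex_Inter_nonempty)
    show "decseq C"
      unfolding C_def decseq_def by (intro allI impI closure_mono hull_mono image_mono) auto
    have "bounded (x ` {0..})"
      using assms by (rule bounded_subset) auto
    then show "bounded (C 0)"
      unfolding C_def by (intro bounded_closure bounded_convex_hull)
  qed (auto simp: C_def convex_closure)
  show thesis
  proof (rule that)
    fix S assume S: "closed S" "convex S" "eventually (\<lambda>k. x k \<in> S) sequentially"
    then obtain n where "x ` {n..} \<subseteq> S"
      by (auto simp: eventually_sequentially)
    with S(1,2) have "C n \<subseteq> S"
      unfolding C_def by (intro closure_minimal hull_minimal)
    with z show "z \<in> S" by blast
  qed
qed

text \<open>The parts of \<open>S\<close> in balls around \<open>p\<close> with radii decreasing to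
  the distance are nested, and a common point attains the distance.\<close>

lemma closed_convex_nearest_point:
  fixes S :: "'a::{real_inner, complete_space} set"
  assumes "closed S" "convex S" "S \<noteq> {}"
  obtains q where "q \<in> S" "\<And>y. y \<in> S \<Longrightarrow> norm (p - q) \<le> norm (p - y)"
proof -
  define d where "d = infdist p S"
  define C where "C n = S \<inter> cball p (d + 1 / real (Suc n))" for n
  obtain q where q: "q \<in> C n" for n
  proof (rule nested_closed_convex_Inter_nonempty)
    show "C n \<noteq> {}" for n
    proof -
      have "d < d + 1 / real (Suc n)" by simp
      then obtain y where "y \<in> S" "dist p y < d + 1 / real (Suc n)"
        using \<open>S \<noteq> {}\<close> cINF_less_iff[of S "dist p" "d + 1 / real (Suc n)"]
        by (auto simp: d_def infdist_def intro!: bdd_belowI2[where m=0])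
      then show ?thesis by (force simp: C_def)
    qed
    show "decseq C"
      unfolding C_def decseq_def by (intro allI impI Int_mono subset_cball) (auto simp: frac_le)
  qed (use assms in \<open>auto simp: C_def intro: convex_Int closed_Int\<close>)
  have "norm (p - q) \<le> d + 1 / real (Suc n)" for n
    using q[of n] by (simp add: C_def dist_norm)
  moreover have "(\<lambda>n. d + 1 / real (Suc n)) \<longlonglongrightarrow> d + 0"
    by (intro tendsto_intros LIMSEQ_Suc[OF lim_1_over_n])
  ultimately have "norm (p - q) \<le> d"
    by (intro LIMSEQ_le_const[where X="\<lambda>n. d + 1 / real (Suc n)"]) auto
  moreover have "d \<le> norm (p - y)" if "y \<in> S" for y
    using infdist_le[OF that, of p] by (simp add: d_def dist_norm)
  ultimately show thesis
    using q[of 0] by (intro that[of q]) (auto simp: C_def intro: order_trans)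
qed

lemma closed_convex_strict_separation:
  fixes S :: "'a::{real_inner, complete_space} set"
  assumes "closed S" "convex S" "p \<notin> S"
  obtains w c where "\<And>y. y \<in> S \<Longrightarrow> inner w y \<le> c" "c < inner w p"
proof (cases "S = {}")
  case True
  then show thesis using that[of 0 "-1"] by simp
next
  case False
  obtain q where q: "q \<in> S" "\<And>y. y \<in> S \<Longrightarrow> norm (p - q) \<le> norm (p - y)"
    using closed_convex_nearest_point[OF assms(1,2) False] by blast
  have "inner (p - q) y \<le> inner (p - q) q" if "y \<in> S" for y
    using any_closest_point_dot[OF assms(2,1) q(1) that, of p] q(2)
    by (simp add: dist_norm inner_diff_right)
  moreover have "inner (p - q) q < inner (p - q) p"
  proof -
    have "inner (p - q) (p - q) > 0" using q(1) assms(3) by auto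
    then show ?thesis by (simp add: inner_diff_right)
  qed
  ultimately show thesis by (rule that)
qed

subsection \<open>Extreme points of closed convex hulls\<close>

text \<open>Expanding \<open>(norm (z - y))\<^sup>2 \<ge> 0\<close> gives one direction, choosing
  \<open>z = y\<close> the other. The epigraph of the paraboloid is thereby an intersection of
  closed half-spaces.\<close>

lemma epigraph_half_norm_square:
  fixes y :: "'a::real_inner"
  shows "(norm y)\<^sup>2 \<le> 2 * t \<longleftrightarrow> (\<forall>z. inner (z, - 1) (y, t) \<le> (norm z)\<^sup>2 / 2)"
proof
  assume t: "(norm y)\<^sup>2 \<le> 2 * t"
  show "\<forall>z. inner (z, - 1) (y, t) \<le> (norm z)\<^sup>2 / 2"
  proof
    fix z
    have "0 \<le> (norm (z - y))\<^sup>2" by simp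
    then show "inner (z, - 1) (y, t) \<le> (norm z)\<^sup>2 / 2"
      using t by (simp add: power2_norm_eq_inner algebra_simps inner_commute)
  qed
next
  assume "\<forall>z. inner (z, - 1) (y, t) \<le> (norm z)\<^sup>2 / 2"
  from this[rule_format, of y] show "(norm y)\<^sup>2 \<le> 2 * t"
    by (simp add: power2_norm_eq_inner)
qed

text \<open>Lets the coercivity bound pass from a set to its closed convex hull.\<close>

lemma closed_convex_epigraph_half_norm_square:
  defines "P \<equiv> {w :: 'a::real_inner \<times> real. (norm (fst w))\<^sup>2 \<le> 2 * snd w}"
  shows "closed P" "convex P"
proof -
  have "P = (\<Inter>z. {w. inner (z, - 1) w \<le> (norm z)\<^sup>2 / 2})"
    unfolding P_def by (auto simp only: epigraph_half_norm_square prod.collapse)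
  then show "closed P" "convex P"
    using closed_halfspace_le convex_halfspace_le by (blast intro: closed_INT convex_INT)+
qed

lemma convex_hull_Un_convex_cases:
  fixes A B :: "'a::real_normed_vector set"
  assumes "convex A" "A \<noteq> {}" "convex B" "B \<noteq> {}" "x \<in> convex hull (A \<union> B)"
  obtains a b u where "a \<in> A" "b \<in> B" "0 \<le> u" "u \<le> 1" "x = u *\<^sub>R a + (1 - u) *\<^sub>R b"
proof -
  have "x \<in> convex hull (\<Union>i\<in>{True, False}. if i then A else B)"
    using assms(5) by (simp add: Un_commute)
  then obtain c s where "\<forall>i\<in>{True, False}. c i \<ge> 0" "sum c {True, False} = 1"
      "\<forall>i\<in>{True, False}. s i \<in> (if i then A else B)" "x = (\<Sum>i\<in>{True, False}. c i *\<^sub>R s i)"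
    using assms(1-4) by (subst (asm) convex_hull_finite_union) auto
  then show thesis
    using that[of "s True" "s False" "c True"] by (auto simp: add.commute eq_diff_eq[symmetric])
qed

text \<open>By coercivity \<open>(norm (l k *\<^sub>R fst (a k)))\<^sup>2 \<le> 2 * (l k * (l k *
  snd (a k)))\<close>, which tends to 0. So the part with vanishing weight contributes only a
  vertical vector \<open>(0, \<tau>)\<close> with \<open>\<tau> \<ge> 0\<close>, and
  \<open>b k\<close> tends to \<open>p - (0, \<tau>)\<close>. As \<open>B\<close> has no point below
  \<open>p\<close> in its fibre, \<open>\<tau> = 0\<close>.\<close>

lemma vanishing_weight_limit:
  fixes a b :: "nat \<Rightarrow> 'a::real_inner \<times> real"
  assumes "closed B" and b: "\<And>k. b k \<in> B"
    and coercive: "\<And>k. (norm (fst (a k)))\<^sup>2 \<le> 2 * snd (a k)"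
    and l: "\<And>k. 0 \<le> l k" "l \<longlonglongrightarrow> 0"
    and height: "(\<lambda>k. l k * snd (a k)) \<longlonglongrightarrow> \<tau>"
    and p: "(\<lambda>k. l k *\<^sub>R a k + (1 - l k) *\<^sub>R b k) \<longlonglongrightarrow> p"
    and lowest: "\<And>t. (fst p, t) \<in> B \<Longrightarrow> snd p \<le> t"
  shows "p \<in> B"
proof -
  have "(\<lambda>k. 2 * (l k * (l k * snd (a k)))) \<longlonglongrightarrow> 2 * (0 * \<tau>)"
    by (intro tendsto_intros l height)
  then have "(\<lambda>k. 2 * (l k * (l k * snd (a k)))) \<longlonglongrightarrow> 0" by simp
  then have "(\<lambda>k. (norm (l k *\<^sub>R fst (a k)))\<^sup>2) \<longlonglongrightarrow> 0"
  proof (rule Lim_null_comparison[rotated], intro always_eventually allI)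
    fix k
    have "(l k)\<^sup>2 * (norm (fst (a k)))\<^sup>2 \<le> (l k)\<^sup>2 * (2 * snd (a k))"
      by (intro mult_left_mono coercive) simp
    then show "norm ((norm (l k *\<^sub>R fst (a k)))\<^sup>2) \<le> 2 * (l k * (l k * snd (a k)))"
      by (simp add: power_mult_distrib power2_eq_square mult_ac)
  qed
  then have "(\<lambda>k. sqrt ((norm (l k *\<^sub>R fst (a k)))\<^sup>2)) \<longlonglongrightarrow> sqrt 0"
    by (rule tendsto_real_sqrt)
  then have "(\<lambda>k. norm (l k *\<^sub>R fst (a k))) \<longlonglongrightarrow> 0"
    by simp
  then have "(\<lambda>k. l k *\<^sub>R fst (a k)) \<longlonglongrightarrow> 0"
    by (rule tendsto_norm_zero_cancel)
  with height have "(\<lambda>k. (l k *\<^sub>R fst (a k), l k * snd (a k))) \<longlonglongrightarrow> (0, \<tau>)"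
    by (intro tendsto_Pair)
  moreover have "(l k *\<^sub>R fst (a k), l k * snd (a k)) = l k *\<^sub>R a k" for k
    by (simp add: prod_eq_iff)
  ultimately have la: "(\<lambda>k. l k *\<^sub>R a k) \<longlonglongrightarrow> (0, \<tau>)"
    by simp
  have "(\<lambda>k. inverse (1 - l k) *\<^sub>R ((l k *\<^sub>R a k + (1 - l k) *\<^sub>R b k) - l k *\<^sub>R a k))
      \<longlonglongrightarrow> inverse (1 - 0) *\<^sub>R (p - (0, \<tau>))"
    by (intro tendsto_intros l p la) simp
  moreover have "\<forall>\<^sub>F k in sequentially.
      inverse (1 - l k) *\<^sub>R ((l k *\<^sub>R a k + (1 - l k) *\<^sub>R b k) - l k *\<^sub>R a k) = b k"
    using order_tendstoD(2)[OF l(2) zero_less_one] by eventually_elim simp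
  ultimately have "b \<longlonglongrightarrow> p - (0, \<tau>)"
    using tendsto_cong by force
  with b have *: "p - (0, \<tau>) \<in> B"
    by (intro Lim_in_closed_set[OF \<open>closed B\<close> always_eventually]) auto
  then have "(fst p, snd p - \<tau>) \<in> B"
    by (simp add: minus_prod_def)
  from lowest[OF this] have "\<tau> \<le> 0" by simp
  moreover have "0 \<le> \<tau>"
  proof (rule LIMSEQ_le_const[OF height], intro exI allI impI)
    fix k
    have "0 \<le> snd (a k)"
      using coercive[of k] zero_le_power2[of "norm (fst (a k))"] by linarith
    with l show "0 \<le> l k * snd (a k)" by simp
  qed
  ultimately show ?thesis
    using * by (simp flip: zero_prod_def)
qed

lemma extreme_point_of_mono:
  assumes "p extreme_point_of E" "F \<subseteq> E" "p \<in> F"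
  shows "p extreme_point_of F"
  using assms by (auto simp: extreme_point_of_def)

lemma coercive_convergent_height_bounded:
  fixes a :: "nat \<Rightarrow> 'a::real_inner \<times> real"
  assumes coercive: "\<And>k. (norm (fst (a k)))\<^sup>2 \<le> 2 * snd (a k)" and "(\<lambda>k. snd (a k)) \<longlonglongrightarrow> s"
  shows "bounded (range a)"
proof -
  have "Bseq (\<lambda>k. snd (a k))"
    using assms(2) convergentI convergent_imp_Bseq by blast
  then obtain M where M: "\<And>k. \<bar>snd (a k)\<bar> \<le> M"
    by (auto simp: Bseq_def)
  have "norm (fst (a k)) \<le> sqrt (2 * M)" for k
    using coercive[of k] M[of k] by (intro real_le_rsqrt) (auto simp: abs_le_iff)
  then have "norm (a k) \<le> sqrt (2 * M) + M" for k
    using norm_Pair_le[of "fst (a k)" "snd (a k)"] M[of k] by (smt (verit) prod.collapse real_norm_def)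
  then show ?thesis
    by (auto simp: bounded_iff)
qed

text \<open>Approach \<open>p\<close> by combinations of \<open>a k\<close> and \<open>b k\<close>
  with convergent weights. A limit weight 0 or 1 puts \<open>p\<close> in one of the sets. Otherwise
  both sequences are bounded, \<open>p\<close> is a proper combination of a point of
  \<open>A\<close> and one of \<open>B\<close>, and extremality makes the two coincide.\<close>

lemma extreme_point_of_closed_convex_Un:
  fixes A B :: "('a::{real_inner, complete_space} \<times> real) set"
  assumes A: "closed A" "convex A" and B: "closed B" "convex B"
    and coercive: "\<And>w. w \<in> A \<union> B \<Longrightarrow> (norm (fst w))\<^sup>2 \<le> 2 * snd w"
    and extreme: "p extreme_point_of closure (convex hull (A \<union> B))"
    and lowest: "\<And>t. (fst p, t) \<in> A \<union> B \<Longrightarrow> snd p \<le> t"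
  shows "p \<in> A \<or> p \<in> B"
proof -
  have p: "p \<in> closure (convex hull (A \<union> B))"
    using extreme by (simp add: extreme_point_of_def)
  have sub: "A \<union> B \<subseteq> closure (convex hull (A \<union> B))"
    by (meson closure_subset hull_subset subset_trans)
  show ?thesis
  proof (cases "A = {} \<or> B = {}")
    case True
    then show ?thesis
      using p A B by (auto simp: hull_same)
  next
    case False
    obtain q where q: "\<And>k. q k \<in> convex hull (A \<union> B)" "q \<longlonglongrightarrow> p"
      using p by (auto simp: closure_sequential)
    have "\<exists>a b u. a \<in> A \<and> b \<in> B \<and> 0 \<le> u \<and> u \<le> 1 \<and> q k = u *\<^sub>R a + (1 - u) *\<^sub>R b" for k
      using convex_hull_Un_convex_cases[OF A(2) _ B(2) _ q(1)[of k]] False by metis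
    then obtain a b l where ab: "\<And>k. a k \<in> A" "\<And>k. b k \<in> B"
      and l: "\<And>k. 0 \<le> l k" "\<And>k. l k \<le> (1::real)"
      and ql: "\<And>k. q k = l k *\<^sub>R a k + (1 - l k) *\<^sub>R b k"
      by metis
    have ca: "(norm (fst (a k)))\<^sup>2 \<le> 2 * snd (a k)" and cb: "(norm (fst (b k)))\<^sup>2 \<le> 2 * snd (b k)" for k
      using coercive ab by auto
    have nn: "0 \<le> snd (a k)" "0 \<le> snd (b k)" for k
      using ca[of k] cb[of k] zero_le_power2[of "norm (fst (a k))"] zero_le_power2[of "norm (fst (b k))"]
      by linarith+
    have snd_q: "snd (q k) = l k * snd (a k) + (1 - l k) * snd (b k)" for k
      by (simp add: ql)
    have "(\<lambda>k. snd (q k)) \<longlonglongrightarrow> snd p"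
      by (intro tendsto_snd q)
    then obtain M where M: "\<And>k. \<bar>snd (q k)\<bar> \<le> M"
      using convergentI convergent_imp_Bseq by (force simp: Bseq_def)
    \<comment> \<open>Both summands of \<open>snd (q k)\<close> are nonnegative by coercivity, so a
      bound on the sum bounds each.\<close>
    have "l k * snd (a k) \<in> {0..M}" for k
    proof -
      have "0 \<le> l k * snd (a k)" "0 \<le> (1 - l k) * snd (b k)"
        using l nn by auto
      with snd_q[of k] M[of k] show ?thesis by auto
    qed
    then have in_box: "\<forall>k. (l k, l k * snd (a k)) \<in> {0..1} \<times> {0..M}"
      using l by auto
    have "seq_compact ({0..1::real} \<times> {0..M})"
      by (intro compact_imp_seq_compact compact_Times compact_Icc)
    then obtain v r where v: "v \<in> {0..1} \<times> {0..M}" and r: "strict_mono (r :: nat \<Rightarrow> nat)"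
      and lim: "((\<lambda>k. (l k, l k * snd (a k))) \<circ> r) \<longlonglongrightarrow> v"
      using in_box by (rule seq_compactE)
    define u \<tau> where "u = fst v" and "\<tau> = snd v"
    have u: "(\<lambda>k. l (r k)) \<longlonglongrightarrow> u" "0 \<le> u" "u \<le> 1"
      using tendsto_fst[OF lim] v by (auto simp: u_def o_def)
    have \<tau>: "(\<lambda>k. l (r k) * snd (a (r k))) \<longlonglongrightarrow> \<tau>"
      using tendsto_snd[OF lim] by (simp add: \<tau>_def o_def)
    have qr: "(\<lambda>k. l (r k) *\<^sub>R a (r k) + (1 - l (r k)) *\<^sub>R b (r k)) \<longlonglongrightarrow> p"
      using LIMSEQ_subseq_LIMSEQ[OF q(2) r] by (simp add: o_def ql)
    have \<sigma>: "(\<lambda>k. (1 - l (r k)) * snd (b (r k))) \<longlonglongrightarrow> snd p - \<tau>"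
      using tendsto_diff[OF tendsto_snd[OF qr] \<tau>] by simp
    consider "u = 0" | "u = 1" | "0 < u" "u < 1"
      using u by linarith
    then show ?thesis
    proof cases
      case 1
      have "p \<in> B"
        by (rule vanishing_weight_limit[OF B(1), of "b \<circ> r" "a \<circ> r" "l \<circ> r"])
          (use ab ca l u 1 \<tau> qr lowest in \<open>auto simp: o_def\<close>)
      then show ?thesis ..
    next
      case 2
      have l': "(\<lambda>k. 1 - l (r k)) \<longlonglongrightarrow> 0"
        using tendsto_diff[OF tendsto_const u(1), of 1] 2 by simp
      have "p \<in> A"
        by (rule vanishing_weight_limit[OF A(1), of "a \<circ> r" "b \<circ> r" "\<lambda>k. 1 - l (r k)"])
          (use ab cb l l' \<sigma> qr lowest in \<open>auto simp: o_def add.commute\<close>)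
      then show ?thesis ..
    next
      case 3
      have pos: "\<forall>\<^sub>F k in sequentially. 0 < l (r k)" "\<forall>\<^sub>F k in sequentially. l (r k) < 1"
        using order_tendstoD[OF u(1)] 3 by auto
      have "(\<lambda>k. l (r k) * snd (a (r k)) / l (r k)) \<longlonglongrightarrow> \<tau> / u"
        using 3 by (intro tendsto_divide \<tau> u) auto
      moreover have "\<forall>\<^sub>F k in sequentially. l (r k) * snd (a (r k)) / l (r k) = snd (a (r k))"
        using pos(1) by eventually_elim simp
      ultimately have "(\<lambda>k. snd (a (r k))) \<longlonglongrightarrow> \<tau> / u"
        using tendsto_cong by force
      then have "bounded (range (a \<circ> r))"
        using ca by (intro coercive_convergent_height_bounded) (auto simp: o_def)
      have "(\<lambda>k. (1 - l (r k)) * snd (b (r k)) / (1 - l (r k))) \<longlonglongrightarrow> (snd p - \<tau>) / (1 - u)"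
        using 3 by (intro tendsto_divide \<sigma> u tendsto_diff tendsto_const) auto
      moreover have "\<forall>\<^sub>F k in sequentially. (1 - l (r k)) * snd (b (r k)) / (1 - l (r k)) = snd (b (r k))"
        using pos(2) by eventually_elim simp
      ultimately have "(\<lambda>k. snd (b (r k))) \<longlonglongrightarrow> (snd p - \<tau>) / (1 - u)"
        using tendsto_cong by force
      then have "bounded (range (b \<circ> r))"
        using cb by (intro coercive_convergent_height_bounded) (auto simp: o_def)
      \<comment> \<open>The combination of both components must pass to the cluster point, so the
        pair is treated as one sequence.\<close>
      define c where "c k = (a (r k), b (r k))" for k
      have "bounded (range c)"
        by (rule bounded_subset[OF bounded_Times[OF \<open>bounded (range (a \<circ> r))\<close> \<open>bounded (range (b \<circ> r))\<close>]])
          (auto simp: c_def)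
      then obtain z where z: "\<And>S. closed S \<Longrightarrow> convex S \<Longrightarrow> eventually (\<lambda>k. c k \<in> S) sequentially \<Longrightarrow> z \<in> S"
        using bounded_sequence_convex_cluster_point by blast
      have zA: "fst z \<in> A" and zB: "snd z \<in> B"
        using z[of "A \<times> B"] A B ab by (auto simp: closed_Times convex_Times c_def mem_Times_iff)
      define L where "L w = u *\<^sub>R fst w + (1 - u) *\<^sub>R snd w" for w :: "('a \<times> real) \<times> ('a \<times> real)"
      have "bounded_linear L"
        unfolding L_def
        by (intro bounded_linear_add bounded_linear_const_scaleR bounded_linear_fst bounded_linear_snd)
      \<comment> \<open>Replacing the weights by their limit \<open>u\<close> changes the
        combination by a null sequence times this bounded one.\<close>
      have "bounded (range (\<lambda>k. a (r k) - b (r k)))"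
        using bounded_minus_comp[OF \<open>bounded (range (a \<circ> r))\<close>[unfolded image_comp]
            \<open>bounded (range (b \<circ> r))\<close>[unfolded image_comp]]
        by (simp add: o_def)
      then have "Bfun (\<lambda>k. a (r k) - b (r k)) sequentially"
        by (auto simp: bounded_iff intro: BseqI')
      moreover have "Zfun (\<lambda>k. u - l (r k)) sequentially"
        using tendsto_diff[OF tendsto_const u(1), of u] by (simp add: tendsto_Zfun_iff)
      ultimately have "(\<lambda>k. (u - l (r k)) *\<^sub>R (a (r k) - b (r k))) \<longlonglongrightarrow> 0"
        by (simp add: tendsto_Zfun_iff bounded_bilinear.Zfun_prod_Bfun[OF bounded_bilinear_scaleR])
      from tendsto_add[OF qr this] have "(\<lambda>k. L (c k)) \<longlonglongrightarrow> p"
        by (simp add: L_def c_def algebra_simps)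
      \<comment> \<open>Only closed convex conditions pass to \<open>z\<close>; membership in the
        preimage of a closed ball under \<open>L\<close> is one.\<close>
      have "dist p (L z) \<le> \<epsilon>" if "\<epsilon> > 0" for \<epsilon>
      proof -
        have "z \<in> L -` cball p \<epsilon>"
        proof (rule z)
          show "closed (L -` cball p \<epsilon>)"
            using \<open>bounded_linear L\<close>
            by (intro closed_vimage linear_continuous_on closed_cball) (auto intro: linear_continuous_at)
          show "convex (L -` cball p \<epsilon>)"
            using \<open>bounded_linear L\<close> by (intro convex_linear_vimage bounded_linear.linear convex_cball)
          show "\<forall>\<^sub>F k in sequentially. c k \<in> L -` cball p \<epsilon>"
            using tendstoD[OF \<open>(\<lambda>k. L (c k)) \<longlonglongrightarrow> p\<close> that]
            by eventually_elim (simp add: dist_commute)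
        qed
        then show ?thesis by simp
      qed
      then have "p = L z"
        by (meson dense_ge dist_le_zero_iff)
      have "fst z = snd z"
      proof (rule ccontr)
        assume "fst z \<noteq> snd z"
        then have "p \<in> open_segment (snd z) (fst z)"
          using 3 \<open>p = L z\<close> unfolding in_segment L_def
          by (auto intro!: exI[of _ u])
        then show False
          using extreme zA zB sub unfolding extreme_point_of_def by blast
      qed
      then have "p = fst z"
        using \<open>p = L z\<close> by (simp add: L_def flip: scaleR_left_distrib)
      with zA show ?thesis by simp
    qed
  qed
qed

text \<open>A form of Milman's converse to the Krein--Milman theorem: \<open>p\<close> lies in the weak closure of \<open>K\<close>.
  Coercivity and the minimality of \<open>p\<close> in its fibre replace weak compactness.\<close>

lemma lowest_extreme_point_halfspaces:
  fixes K :: "('a::{real_inner, complete_space} \<times> real) set"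
  assumes coercive: "\<And>w. w \<in> K \<Longrightarrow> (norm (fst w))\<^sup>2 \<le> 2 * snd w"
    and extreme: "p extreme_point_of closure (convex hull K)"
    and lowest: "\<And>t. (fst p, t) \<in> closure (convex hull K) \<Longrightarrow> snd p \<le> t"
    and "finite D" and D: "\<And>\<phi> c. (\<phi>, c) \<in> D \<Longrightarrow> bounded_linear \<phi> \<and> \<phi> p < (c::real)"
  shows "p \<in> closure (convex hull {w \<in> K. \<forall>(\<phi>, c)\<in>D. \<phi> w < c})"
  using \<open>finite D\<close> D
proof (induction D rule: finite_induct)
  case empty
  then show ?case using extreme by (simp add: extreme_point_of_def)
next
  case (insert d D)
  obtain \<phi> c where d: "d = (\<phi>, c)" by (cases d)
  have \<phi>: "bounded_linear \<phi>" "\<phi> p < c"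
    using insert.prems[of \<phi> c] d by auto
  define K' where "K' = {w \<in> K. \<forall>(\<phi>, c)\<in>D. \<phi> w < c}"
  \<comment> \<open>The new half-space splits \<open>K'\<close> in two, and the extreme point
    \<open>p\<close> must lie in the closed convex hull of one part.\<close>
  define A where "A = closure (convex hull {w \<in> K'. c \<le> \<phi> w})"
  define B where "B = closure (convex hull {w \<in> K'. \<phi> w < c})"
  have sub: "A \<subseteq> closure (convex hull K)" "B \<subseteq> closure (convex hull K)"
    unfolding A_def B_def by (intro closure_mono hull_mono; auto simp: K'_def)+
  have "p \<in> closure (convex hull K')"
    unfolding K'_def using insert.IH insert.prems by blast
  moreover have "K' \<subseteq> A \<union> B"
  proof
    fix w assume "w \<in> K'"
    then have "w \<in> {w \<in> K'. c \<le> \<phi> w} \<or> w \<in> {w \<in> K'. \<phi> w < c}" by auto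
    then show "w \<in> A \<union> B"
      unfolding A_def B_def by (meson UnI1 UnI2 closure_subset hull_inc subset_iff)
  qed
  ultimately have "p \<in> closure (convex hull (A \<union> B))"
    using closure_mono hull_mono by blast
  moreover have "closure (convex hull (A \<union> B)) \<subseteq> closure (convex hull K)"
    using sub by (intro closure_minimal hull_minimal) (auto simp: convex_closure)
  ultimately have "p extreme_point_of closure (convex hull (A \<union> B))"
    using extreme_point_of_mono[OF extreme] by blast
  moreover have "closure (convex hull K) \<subseteq> {w. (norm (fst w))\<^sup>2 \<le> 2 * snd w}"
    using coercive by (intro closure_minimal hull_minimal closed_convex_epigraph_half_norm_square) auto
  ultimately have "p \<in> A \<or> p \<in> B"
    using sub lowest
    by (intro extreme_point_of_closed_convex_Un) (auto simp: A_def B_def convex_closure)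
  \<comment> \<open>The discarded points satisfy a closed convex condition that \<open>p\<close>
    violates.\<close>
  moreover have "A \<subseteq> {w. c \<le> \<phi> w}"
    unfolding A_def
  proof (intro closure_minimal hull_minimal)
    have "{w. c \<le> \<phi> w} = \<phi> -` {c..}" by auto
    moreover have "closed (\<phi> -` {c..})"
      using \<phi>(1) by (intro closed_vimage) (auto intro: linear_continuous_on)
    moreover have "convex (\<phi> -` {c..})"
      using \<phi>(1) by (intro convex_linear_vimage) (auto intro: bounded_linear.linear)
    ultimately show "closed {w. c \<le> \<phi> w}" "convex {w. c \<le> \<phi> w}" by simp_all
  qed auto
  ultimately have "p \<in> B" using \<phi>(2) by auto
  moreover have "{w \<in> K'. \<phi> w < c} = {w \<in> K. \<forall>(\<phi>, c)\<in>insert d D. \<phi> w < c}"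
    by (auto simp: K'_def d)
  ultimately show ?case by (simp add: B_def)
qed

subsection \<open>The weak topology and the transform\<close>

text \<open>One-sided strict inequalities are the form in which
  \<open>lowest_extreme_point_halfspaces\<close> takes its constraints.\<close>

lemma weakly_open_contains_halfspaces:
  assumes "openin weak_topology U" "x \<in> U"
  obtains D where "finite D" "\<forall>(\<phi>, c)\<in>D. bounded_linear \<phi> \<and> \<phi> x < (c::real)"
    "{z. \<forall>(\<phi>, c)\<in>D. \<phi> z < c} \<subseteq> U"
proof -
  have gen: "generate_topology_on {\<phi> -` U | (\<phi> :: 'a \<Rightarrow> real) U. bounded_linear \<phi> \<and> open U} U"
    using assms(1) unfolding weak_topology_def by (rule openin_topology_generated_by)
  define N where "N x D V \<longleftrightarrow> finite D \<and> (\<forall>(\<phi>, c)\<in>D. bounded_linear \<phi> \<and> \<phi> x < c) \<and>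
      {z. \<forall>(\<phi>, c)\<in>D. \<phi> z < c} \<subseteq> V" for x and D :: "(('a \<Rightarrow> real) \<times> real) set" and V
  have "\<exists>D. N x D U"
    using gen \<open>x \<in> U\<close>
  proof (induction arbitrary: x)
    case Empty
    then show ?case by simp
  next
    case (Int a b)
    then obtain D1 D2 where "N x D1 a" "N x D2 b" by blast
    then have "N x (D1 \<union> D2) (a \<inter> b)"
      unfolding N_def by (auto simp: ball_Un)
    then show ?case ..
  next
    case (UN K)
    then obtain k D where "k \<in> K" "N x D k" by blast
    then have "N x D (\<Union>K)"
      unfolding N_def by (meson Union_upper subset_trans)
    then show ?case ..
  next
    case (Basis s)
    then obtain \<phi> V where s: "s = \<phi> -` V" and \<phi>: "bounded_linear (\<phi> :: 'a \<Rightarrow> real)" and "open V"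
      by blast
    with Basis.prems obtain e where e: "e > 0" "ball (\<phi> x) e \<subseteq> V"
      by (auto simp: open_contains_ball)
    \<comment> \<open>An interval around \<open>\<phi> x\<close> is the intersection of two rays,
      described by \<open>\<phi>\<close> and its negative.\<close>
    have "bounded_linear (\<lambda>z. - \<phi> z)"
      using \<phi> by (rule bounded_linear_minus)
    moreover have "z \<in> s" if "\<phi> z < \<phi> x + e" "- \<phi> z < - \<phi> x + e" for z
      using that e s by (auto simp: dist_real_def subset_iff abs_less_iff)
    ultimately have "N x {(\<phi>, \<phi> x + e), (\<lambda>z. - \<phi> z, - \<phi> x + e)} s"
      using \<phi> e by (auto simp: N_def)
    then show ?case ..
  qed
  then obtain D where "N x D U" ..
  then show thesis by (intro that[of D]) (auto simp: N_def)
qed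

section \<open>The double transform as a closed convex envelope\<close>

lemma S_transform_le_iff:
  "S_transform g y \<le> ereal c \<longleftrightarrow> (\<forall>x. ereal (- c - (norm (x - y))\<^sup>2 / 2) \<le> g x)"
proof -
  have "- g x - ereal (1 / 2 * (norm (x - y))\<^sup>2) \<le> ereal c \<longleftrightarrow>
      ereal (- c - (norm (x - y))\<^sup>2 / 2) \<le> g x" for x
    by (cases "g x") auto
  then show ?thesis
    by (simp add: S_transform_def SUP_le_iff)
qed

text \<open>Expanding the squares turns the transforms into Legendre transforms: with half the
  squared norm added, the double transform of \<open>f\<close> is the supremum of the affine
  minorants \<open>inner y z - b\<close>. Comparison with real bounds \<open>r\<close> avoids
  arithmetic with infinite values.\<close>

lemma S_transform_S_transform_le_iff:
  fixes f :: "'a::real_inner \<Rightarrow> ereal"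
  shows "S_transform (S_transform f) x \<le> ereal r \<longleftrightarrow>
    (\<forall>y b. (\<forall>z. ereal (inner y z - b - (norm z)\<^sup>2 / 2) \<le> f z) \<longrightarrow> inner y x - b \<le> r + (norm x)\<^sup>2 / 2)"
    (is "_ \<longleftrightarrow> ?R")
proof -
  have square: "(norm (z - y))\<^sup>2 / 2 = (norm z)\<^sup>2 / 2 - inner y z + (norm y)\<^sup>2 / 2" for z y :: 'a
    by (simp add: power2_norm_eq_inner inner_diff_left inner_diff_right inner_commute field_simps)
  have "S_transform (S_transform f) x \<le> ereal r \<longleftrightarrow>
      (\<forall>y. ereal (- r - (norm (y - x))\<^sup>2 / 2) \<le> S_transform f y)"
    by (rule S_transform_le_iff)
  also have "\<dots> \<longleftrightarrow> (\<forall>y c. S_transform f y \<le> ereal c \<longrightarrow> - r - (norm (y - x))\<^sup>2 / 2 \<le> c)"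
  proof -
    have "ereal a \<le> s \<longleftrightarrow> (\<forall>c. s \<le> ereal c \<longrightarrow> a \<le> c)" for a s
      by (metis ereal_le_real ereal_less_eq(3) order_trans)
    then show ?thesis by simp
  qed
  \<comment> \<open>The offset \<open>b\<close> is \<open>c + (norm y)\<^sup>2 / 2\<close>, which
    for fixed \<open>y\<close> ranges over all reals with \<open>c\<close>.\<close>
  also have "\<dots> \<longleftrightarrow> (\<forall>y c. (\<forall>z. ereal (inner y z - (c + (norm y)\<^sup>2 / 2) - (norm z)\<^sup>2 / 2) \<le> f z)
      \<longrightarrow> inner y x - (c + (norm y)\<^sup>2 / 2) \<le> r + (norm x)\<^sup>2 / 2)"
    unfolding S_transform_le_iff norm_minus_commute[of _ x] square by (simp add: algebra_simps)
  also have "\<dots> \<longleftrightarrow> ?R" (is "?L \<longleftrightarrow> _")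
  proof
    assume L: ?L
    show ?R
    proof (intro allI impI)
      fix y b assume "\<forall>z. ereal (inner y z - b - (norm z)\<^sup>2 / 2) \<le> f z"
      then show "inner y x - b \<le> r + (norm x)\<^sup>2 / 2"
        using L[rule_format, of y "b - (norm y)\<^sup>2 / 2"] by simp
    qed
  qed blast
  finally show ?thesis .
qed

text \<open>Fenchel-Moreau for \<open>f\<close> plus half the squared norm, whose epigraph is
  \<open>epi f\<close>; the square stands on the real side. One inclusion holds since
  \<open>?G\<close> is an intersection of half-spaces, the other by separating a point from
  \<open>?E\<close>.\<close>

lemma closure_convex_hull_epigraph_eq:
  fixes f :: "'a::{real_inner, complete_space} \<Rightarrow> ereal"
  assumes nonneg: "\<And>x. 0 \<le> f x"
  defines "epi \<equiv> \<lambda>g. {w. g (fst w) \<le> ereal (snd w - (norm (fst w))\<^sup>2 / 2)}"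
  shows "closure (convex hull epi f) = epi (S_transform (S_transform f))" (is "?E = ?G")
proof
  define minorant where "minorant y b \<longleftrightarrow> (\<forall>z. ereal (inner y z - b - (norm z)\<^sup>2 / 2) \<le> f z)" for y b
  have G_iff: "(x, s) \<in> ?G \<longleftrightarrow> (\<forall>y b. minorant y b \<longrightarrow> inner y x - b \<le> s)" for x s
    by (simp add: epi_def S_transform_S_transform_le_iff minorant_def)
  have G: "?G = (\<Inter>(y, b)\<in>{(y, b). minorant y b}. {w. inner (y, - 1) w \<le> b})"
  proof (rule set_eqI)
    fix w
    show "w \<in> ?G \<longleftrightarrow> w \<in> (\<Inter>(y, b)\<in>{(y, b). minorant y b}. {w. inner (y, - 1) w \<le> b})"
      using G_iff[of "fst w" "snd w"] by (cases w) (auto simp: algebra_simps)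
  qed
  show "?E \<subseteq> ?G"
  proof (intro closure_minimal hull_minimal)
    show "epi f \<subseteq> ?G"
    proof
      fix w assume w: "w \<in> epi f"
      have "inner y (fst w) - b \<le> snd w" if "minorant y b" for y b
      proof -
        have "ereal (inner y (fst w) - b - (norm (fst w))\<^sup>2 / 2) \<le> ereal (snd w - (norm (fst w))\<^sup>2 / 2)"
          using that w unfolding minorant_def epi_def by (blast intro: order_trans)
        then show ?thesis by simp
      qed
      then show "w \<in> ?G" using G_iff[of "fst w" "snd w"] by simp
    qed
    show "closed ?G" "convex ?G"
      unfolding G by (auto intro!: closed_INT convex_INT closed_halfspace_le convex_halfspace_le simp del: inner_Pair)
  qed
  show "?G \<subseteq> ?E"
  proof (rule subsetI, rule ccontr)
    fix w assume "w \<in> ?G" "w \<notin> ?E"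
    obtain x s where w: "w = (x, s)" by (cases w)
    obtain v c where v: "\<And>e. e \<in> ?E \<Longrightarrow> inner v e \<le> c" "c < inner v w"
      using closed_convex_strict_separation[OF closed_closure convex_closure[OF convex_convex_hull] \<open>w \<notin> ?E\<close>]
      by blast
    obtain y a where ya: "v = (y, a)" by (cases v)
    have below: "inner y z + a * t \<le> c" if "f z \<le> ereal (t - (norm z)\<^sup>2 / 2)" for z t
    proof -
      have "(z, t) \<in> ?E"
        using that closure_subset by (intro subsetD[OF closure_subset] hull_inc) (simp add: epi_def)
      from v(1)[OF this] show ?thesis by (simp add: ya)
    qed
    have above: "c < inner y x + a * s"
      using v(2) by (simp add: ya w)
    have bound: "inner y' x - b \<le> s" if "minorant y' b" for y' b
      using \<open>w \<in> ?G\<close> that G_iff w by simp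
    consider "\<And>z. f z = \<infinity>" | z r where "f z = ereal r"
      using nonneg by (metis ereal_cases ereal_infty_less_eq2(2) ereal_less_eq(2) MInfty_neq_ereal(1) zero_ereal_def)
    then show False
    proof cases
      case 1
      \<comment> \<open>With \<open>f\<close> infinite everywhere every affine function is a
        minorant; this one is the constant \<open>s + 1\<close>.\<close>
      then have "minorant 0 (- s - 1)" by (simp add: minorant_def)
      from bound[OF this] show False by simp
    next
      case (2 z0 r0)
      have le: "a * t \<le> c - inner y z0" if "r0 + (norm z0)\<^sup>2 / 2 \<le> t" for t
        using below[of z0 t] that 2 by simp
      \<comment> \<open>The epigraph is unbounded upwards over \<open>z0\<close>, so the vertical
        component cannot be positive.\<close>
      have "a \<le> 0"
      proof (rule ccontr)
        assume "\<not> a \<le> 0"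
        define t where "t = max (r0 + (norm z0)\<^sup>2 / 2) ((c - inner y z0 + 1) / a)"
        have "a * ((c - inner y z0 + 1) / a) \<le> a * t"
          using \<open>\<not> a \<le> 0\<close> by (intro mult_left_mono) (auto simp: t_def)
        with le[of t] \<open>\<not> a \<le> 0\<close> show False by (simp add: t_def)
      qed
      then consider "a < 0" | "a = 0" by linarith
      then show False
      proof cases
        case 1
        \<comment> \<open>Division by \<open>- a\<close> makes a non-vertical separating hyperplane
          the graph of an affine minorant.\<close>
        have "minorant (y /\<^sub>R (- a)) (c / (- a))"
          unfolding minorant_def
        proof
          fix z
          show "ereal (inner (y /\<^sub>R (- a)) z - c / (- a) - (norm z)\<^sup>2 / 2) \<le> f z"
          proof (cases "f z")
            case (real r)
            then have "inner y z + a * (r + (norm z)\<^sup>2 / 2) \<le> c"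
              by (intro below) simp
            then show ?thesis
              using 1 real by (simp add: field_simps)
          qed (use nonneg[of z] in auto)
        qed
        from bound[OF this] above 1 show False by (simp add: field_simps)
      next
        case 2
        \<comment> \<open>A vertical hyperplane only gives \<open>inner y z \<le> c\<close> wherever
          \<open>f z\<close> is finite. As \<open>f\<close> is nonnegative, every positive multiple
          of \<open>inner y z - c\<close> is then a minorant; the factor \<open>t\<close> gives it
          the value \<open>\<bar>s\<bar> + 1\<close> at \<open>x\<close>, above
          \<open>s\<close>.\<close>
        define t where "t = (\<bar>s\<bar> + 1) / (inner y x - c)"
        have "t > 0" using above 2 by (simp add: t_def)
        have "minorant (t *\<^sub>R y) (t * c)"
          unfolding minorant_def
        proof
          fix z
          show "ereal (inner (t *\<^sub>R y) z - t * c - (norm z)\<^sup>2 / 2) \<le> f z"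
          proof (cases "f z")
            case (real r)
            then have "inner y z \<le> c"
              using below[of z "r + (norm z)\<^sup>2 / 2"] 2 by simp
            then have "t * inner y z \<le> t * c"
              using \<open>t > 0\<close> by simp
            then have "t * inner y z - t * c - (norm z)\<^sup>2 / 2 \<le> 0"
              using zero_le_power2[of "norm z"] by linarith
            then show ?thesis
              using nonneg[of z] by (simp add: order_trans[OF _ nonneg])
          qed (use nonneg[of z] in auto)
        qed
        from bound[OF this] have "t * (inner y x - c) \<le> s"
          by (simp add: algebra_simps)
        then show False
          using above 2 by (simp add: t_def)
      qed
    qed
  qed
qed

lemma S_transform_S_transform_le: "S_transform (S_transform f) x \<le> f x"
proof (rule ereal_le_real)
  fix r assume r: "f x \<le> ereal r"
  have "ereal (- r - (norm (y - x))\<^sup>2 / 2) \<le> S_transform f y" for y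
  proof -
    have "ereal (- r - (norm (y - x))\<^sup>2 / 2) \<le> - f x - ereal (1 / 2 * (norm (x - y))\<^sup>2)"
      using r by (cases "f x") (auto simp: norm_minus_commute)
    also have "\<dots> \<le> S_transform f y"
      unfolding S_transform_def by (rule SUP_upper) simp
    finally show ?thesis .
  qed
  then show "S_transform (S_transform f) x \<le> ereal r"
    unfolding S_transform_le_iff by blast
qed

lemma S_transform_S_transform_nonneg:
  assumes "\<And>x. 0 \<le> f x"
  shows "0 \<le> S_transform (S_transform f) x"
proof -
  have "S_transform f x \<le> ereal 0"
    unfolding S_transform_le_iff
    using assms by (auto intro: order_trans[of _ 0])
  then have "0 \<le> - S_transform f x - ereal (1 / 2 * (norm (x - x))\<^sup>2)"
    by (cases "S_transform f x") (auto simp: zero_ereal_def)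
  also have "\<dots> \<le> S_transform (S_transform f) x"
    unfolding S_transform_def[of "S_transform f"] by (rule SUP_upper) simp
  finally show ?thesis .
qed

text \<open>A weak neighbourhood of \<open>x\<^sub>0\<close> on which \<open>f\<close> is large, cut by one more half-space on which
  \<open>\<parallel>\<cdot>\<parallel>\<^sup>2\<close> is almost as large as at \<open>x\<^sub>0\<close>, separates \<open>p\<close> weakly from the epigraph.\<close>

lemma epigraph_lowest_not_extreme:
  fixes f :: "'a::{real_inner, complete_space} \<Rightarrow> ereal"
  assumes nonneg: "\<And>x. 0 \<le> f x"
    and wlsc: "weakly_lower_semicontinuous f"
    and s: "S_transform (S_transform f) x\<^sub>0 = ereal s" "ereal s < f x\<^sub>0"
  shows "\<not> (x\<^sub>0, s + (norm x\<^sub>0)\<^sup>2 / 2) extreme_point_of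
    {w. S_transform (S_transform f) (fst w) \<le> ereal (snd w - (norm (fst w))\<^sup>2 / 2)}"
proof
  define p where "p = (x\<^sub>0, s + (norm x\<^sub>0)\<^sup>2 / 2)"
  define K where "K = {w. f (fst w) \<le> ereal (snd w - (norm (fst w))\<^sup>2 / 2)}"
  assume "(x\<^sub>0, s + (norm x\<^sub>0)\<^sup>2 / 2) extreme_point_of
    {w. S_transform (S_transform f) (fst w) \<le> ereal (snd w - (norm (fst w))\<^sup>2 / 2)}"
  then have extreme: "p extreme_point_of closure (convex hull K)"
    using closure_convex_hull_epigraph_eq[of f] nonneg by (simp add: p_def K_def)
  have lowest: "snd p \<le> t" if "(fst p, t) \<in> closure (convex hull K)" for t
    using that closure_convex_hull_epigraph_eq[of f] nonneg s by (simp add: p_def K_def)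
  obtain e where e: "ereal s < e" "e < f x\<^sub>0"
    using s(2) dense by blast
  then obtain s' where s': "s < s'" "ereal s' < f x\<^sub>0"
    by (cases e) auto
  have "openin weak_topology {x \<in> topspace weak_topology. ereal s' < f x}"
    using wlsc by (simp add: lower_semicontinuous_map_def)
  moreover have "UNIV \<in> {\<phi> -` U | (\<phi> :: 'a \<Rightarrow> real) U. bounded_linear \<phi> \<and> open U}"
    by (rule CollectI, intro exI[of _ "\<lambda>_. 0"] exI[of _ UNIV]) simp
  then have "topspace (weak_topology :: 'a topology) = UNIV"
    unfolding weak_topology_def topology_generated_by_topspace by blast
  ultimately have "openin weak_topology {x. ereal s' < f x}" by simp
  moreover have "x\<^sub>0 \<in> {x. ereal s' < f x}" using s'(2) by simp
  ultimately obtain D where D: "finite D" "\<forall>(\<phi>, c)\<in>D. bounded_linear \<phi> \<and> \<phi> x\<^sub>0 < (c::real)"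
      "{z. \<forall>(\<phi>, c)\<in>D. \<phi> z < c} \<subseteq> {x. ereal s' < f x}"
    by (rule weakly_open_contains_halfspaces)
  \<comment> \<open>The height bound and the norm estimate below cost \<open>\<delta>\<close> each,
    which together use up the gap exactly.\<close>
  define \<delta> where "\<delta> = (s' - s) / 2"
  have \<delta>: "\<delta> > 0" "s + 2 * \<delta> = s'" using s' by (auto simp: \<delta>_def field_simps)
  \<comment> \<open>The weak neighbourhood is lifted through \<open>fst\<close>; the two further
    half-spaces bound the norm of \<open>fst w\<close> from below and the height from above.\<close>
  define D' where "D' = (\<lambda>(\<phi>, c). (\<phi> \<circ> fst, c)) ` D \<union>
    {(\<lambda>w. - inner x\<^sub>0 (fst w), - (norm x\<^sub>0)\<^sup>2 + \<delta>), (snd, snd p + \<delta>)}"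
  have "p \<in> closure (convex hull {w \<in> K. \<forall>(\<phi>, c)\<in>D'. \<phi> w < c})"
  proof (rule lowest_extreme_point_halfspaces[OF _ extreme lowest])
    show "(norm (fst w))\<^sup>2 \<le> 2 * snd w" if "w \<in> K" for w
    proof -
      have "0 \<le> ereal (snd w - (norm (fst w))\<^sup>2 / 2)"
        using nonneg that unfolding K_def by (blast intro: order_trans)
      then show ?thesis by simp
    qed
    show "finite D'" using D(1) by (simp add: D'_def)
    show "bounded_linear \<phi> \<and> \<phi> p < c" if in_D': "(\<phi>, c) \<in> D'" for \<phi> c
    proof -
      consider \<psi> where "(\<psi>, c) \<in> D" "\<phi> = \<psi> \<circ> fst"
        | "\<phi> = (\<lambda>w. - inner x\<^sub>0 (fst w))" "c = - (norm x\<^sub>0)\<^sup>2 + \<delta>" | "\<phi> = snd" "c = snd p + \<delta>"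
        using in_D' unfolding D'_def by auto
      then show ?thesis
      proof cases
        case 1
        then show ?thesis
          using D(2) by (auto simp: p_def o_def intro: bounded_linear_compose bounded_linear_fst)
      next
        case 2
        have "bounded_linear (\<lambda>w. - inner x\<^sub>0 (fst w :: 'a))"
          by (intro bounded_linear_minus bounded_linear_compose[OF bounded_linear_inner_right] bounded_linear_fst)
        then show ?thesis
          using 2 \<delta> by (simp add: p_def power2_norm_eq_inner)
      next
        case 3
        then show ?thesis using \<delta> by (simp add: bounded_linear_snd)
      qed
    qed
  qed
  moreover have "{w \<in> K. \<forall>(\<phi>, c)\<in>D'. \<phi> w < c} = {}"
  proof (rule equals0I)
    fix w assume w: "w \<in> {w \<in> K. \<forall>(\<phi>, c)\<in>D'. \<phi> w < c}"
    have "\<forall>(\<phi>, c)\<in>D. \<phi> (fst w) < c"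
      using w unfolding D'_def by fastforce
    then have "ereal s' < f (fst w)"
      using D(3) by blast
    also have "\<dots> \<le> ereal (snd w - (norm (fst w))\<^sup>2 / 2)"
      using w by (simp add: K_def)
    finally have "s' < snd w - (norm (fst w))\<^sup>2 / 2" by simp
    moreover have "(norm x\<^sub>0)\<^sup>2 - \<delta> < inner x\<^sub>0 (fst w)" "snd w < s + (norm x\<^sub>0)\<^sup>2 / 2 + \<delta>"
      using w by (auto simp: D'_def p_def)
    \<comment> \<open>With the half-space bound on \<open>inner x\<^sub>0 (fst w)\<close> this
      yields \<open>(norm (fst w))\<^sup>2 > (norm x\<^sub>0)\<^sup>2 - 2 *
      \<delta>\<close>.\<close>
    moreover have "0 \<le> (norm (fst w - x\<^sub>0))\<^sup>2" by simp
    then have "2 * inner x\<^sub>0 (fst w) \<le> (norm (fst w))\<^sup>2 + (norm x\<^sub>0)\<^sup>2"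
      by (simp add: power2_norm_eq_inner algebra_simps inner_commute)
    ultimately show False using \<delta> by linarith
  qed
  ultimately show False by simp
qed

section \<open>The dichotomy at a given point\<close>

theorem theorem1p1:
  fixes f :: "'v::{real_inner, complete_space} \<Rightarrow> ereal"
    and x\<^sub>0 :: 'v
  assumes separable: "separable_space (euclidean :: 'v topology)"
    and nonneg: "\<And>x. 0 \<le> f x"
    and wlsc: "weakly_lower_semicontinuous f"
  shows "f x\<^sub>0 = S_transform (S_transform f) x\<^sub>0 \<or>
    (\<exists>(\<nu>::'v) (t\<^sub>0::real) (h::real \<Rightarrow> real) (h'::real \<Rightarrow> real).
       norm \<nu> = 1 \<and> 0 < t\<^sub>0 \<and>
       (\<forall>t\<in>{-t\<^sub>0<..<t\<^sub>0}.
          S_transform (S_transform f) (x\<^sub>0 + t *\<^sub>R \<nu>) = ereal (h t) \<and>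
          (h has_real_derivative h' t) (at t) \<and>
          (h' has_real_derivative -1) (at t)))"
proof (cases "f x\<^sub>0 = S_transform (S_transform f) x\<^sub>0")
  case False
  let ?F = "S_transform (S_transform f)"
  have "?F x\<^sub>0 < f x\<^sub>0"
    using False S_transform_S_transform_le[of f x\<^sub>0] by (simp add: less_le)
  moreover have "0 \<le> ?F x\<^sub>0"
    using nonneg by (rule S_transform_S_transform_nonneg)
  ultimately obtain s where s: "?F x\<^sub>0 = ereal s"
    by (cases "?F x\<^sub>0") auto
  define r where "r = s + (norm x\<^sub>0)\<^sup>2 / 2"
  define E where "E = {w. ?F (fst w) \<le> ereal (snd w - (norm (fst w))\<^sup>2 / 2)}"
  have "convex E"
    unfolding E_def closure_convex_hull_epigraph_eq[OF nonneg, symmetric]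
    by (intro convex_closure convex_convex_hull)
  have lowest: "r \<le> t" if "(x\<^sub>0, t) \<in> E" for t
    using that s by (simp add: E_def r_def)
  have pE: "(x\<^sub>0, r) \<in> E"
    using s by (simp add: E_def r_def)
  have "\<not> (x\<^sub>0, r) extreme_point_of E"
    using epigraph_lowest_not_extreme[OF nonneg wlsc s] \<open>?F x\<^sub>0 < f x\<^sub>0\<close> s by (simp add: E_def r_def)
  then obtain w1 w2 where w: "w1 \<in> E" "w2 \<in> E" "(x\<^sub>0, r) \<in> open_segment w1 w2"
    using pE by (auto simp: extreme_point_of_def)
  obtain x1 r1 x2 r2 where w12: "w1 = (x1, r1)" "w2 = (x2, r2)" by (cases w1, cases w2)
  obtain u where "w1 \<noteq> w2" and u: "0 < u" "u < 1" and pu: "(x\<^sub>0, r) = (1 - u) *\<^sub>R w1 + u *\<^sub>R w2"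
    using w(3) by (auto simp: in_segment)
  have x0: "x\<^sub>0 = (1 - u) *\<^sub>R x1 + u *\<^sub>R x2" and r: "r = (1 - u) * r1 + u * r2"
    using pu by (auto simp: w12)
  \<comment> \<open>On a vertical segment both ends would have height at least \<open>r\<close> with
    weighted mean \<open>r\<close>, and would coincide.\<close>
  have "x1 \<noteq> x2"
  proof
    assume "x1 = x2"
    then have "x1 = x\<^sub>0" "x2 = x\<^sub>0" using x0 by (simp_all flip: scaleR_left_distrib)
    then have "r \<le> r1" "r \<le> r2" using lowest w w12 by auto
    moreover have "(1 - u) * (r1 - r) + u * (r2 - r) = 0"
      using r by (simp add: algebra_simps)
    moreover have "0 \<le> (1 - u) * (r1 - r)" "0 \<le> u * (r2 - r)"
      using u \<open>r \<le> r1\<close> \<open>r \<le> r2\<close> by auto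
    ultimately have "(1 - u) * (r1 - r) = 0" "u * (r2 - r) = 0" by linarith+
    then have "r1 = r2" using u by simp
    with \<open>x1 = x2\<close> \<open>w1 \<noteq> w2\<close> w12 show False by simp
  qed
  define d where "d = norm (x2 - x1)"
  have "d > 0" using \<open>x1 \<noteq> x2\<close> by (simp add: d_def)
  define \<nu> where "\<nu> = (x2 - x1) /\<^sub>R d"
  define m where "m = (r2 - r1) / d"
  \<comment> \<open>The ends \<open>x1\<close> and \<open>x2\<close> lie at distances
    \<open>d * u\<close> and \<open>d * (1 - u)\<close> from \<open>x\<^sub>0\<close>; the smaller
    one keeps parameters of both signs on the segment.\<close>
  define t0 where "t0 = d * min u (1 - u)"
  have "norm \<nu> = 1" using \<open>d > 0\<close> by (simp add: \<nu>_def d_def)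
  have "t0 > 0" using \<open>d > 0\<close> u by (simp add: t0_def)
  have line: "(x\<^sub>0 + t *\<^sub>R \<nu>, r + t * m) \<in> E" if "\<bar>t\<bar> < t0" for t
  proof -
    have "\<bar>t / d\<bar> < min u (1 - u)"
      using that \<open>d > 0\<close> by (simp add: t0_def abs_divide pos_divide_less_eq mult.commute del: min_less_iff_conj)
    then have "0 \<le> u + t / d" "u + t / d \<le> 1" by linarith+
    then have "(1 - (u + t / d)) *\<^sub>R w1 + (u + t / d) *\<^sub>R w2 \<in> E"
      using w \<open>convex E\<close> by (intro convexD) auto
    moreover have "(1 - (u + t / d)) *\<^sub>R w1 + (u + t / d) *\<^sub>R w2 = (x\<^sub>0 + t *\<^sub>R \<nu>, r + t * m)"
      by (simp add: w12 x0 r \<nu>_def m_def algebra_simps divide_inverse)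
    ultimately show ?thesis by simp
  qed
  \<comment> \<open>The chord minus the quadratic; since \<open>\<nu>\<close> is a unit vector, this
    is a parabola with leading coefficient -1/2.\<close>
  define h where "h t = r + t * m - (norm (x\<^sub>0 + t *\<^sub>R \<nu>))\<^sup>2 / 2" for t
  have h_eq: "h = (\<lambda>t. s + t * (m - inner x\<^sub>0 \<nu>) - t\<^sup>2 / 2)"
  proof
    fix t
    have "(norm (x\<^sub>0 + t *\<^sub>R \<nu>))\<^sup>2 = (norm x\<^sub>0)\<^sup>2 + 2 * t * inner x\<^sub>0 \<nu> + t\<^sup>2 * (norm \<nu>)\<^sup>2"
      by (simp add: power2_norm_eq_inner algebra_simps inner_commute power2_eq_square[of t])
    then show "h t = s + t * (m - inner x\<^sub>0 \<nu>) - t\<^sup>2 / 2"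
      by (simp add: h_def r_def \<open>norm \<nu> = 1\<close> field_simps)
  qed
  have "?F (x\<^sub>0 + t *\<^sub>R \<nu>) = ereal (h t)" if "\<bar>t\<bar> < t0" for t
  proof (rule antisym)
    show "?F (x\<^sub>0 + t *\<^sub>R \<nu>) \<le> ereal (h t)"
      using line[OF that] by (simp add: E_def h_def)
    \<comment> \<open>A point of \<open>E\<close> below the chord at \<open>t\<close>, averaged with
      the chord point at \<open>- t\<close>, would lie over \<open>x\<^sub>0\<close> below height
      \<open>r\<close>.\<close>
    show "ereal (h t) \<le> ?F (x\<^sub>0 + t *\<^sub>R \<nu>)"
    proof (rule ereal_le_real)
      fix z assume "?F (x\<^sub>0 + t *\<^sub>R \<nu>) \<le> ereal z"
      then have "(x\<^sub>0 + t *\<^sub>R \<nu>, z + (norm (x\<^sub>0 + t *\<^sub>R \<nu>))\<^sup>2 / 2) \<in> E"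
        by (simp add: E_def)
      moreover have "(x\<^sub>0 + (- t) *\<^sub>R \<nu>, r + (- t) * m) \<in> E"
        using that by (intro line) simp
      ultimately have "(1 / 2) *\<^sub>R (x\<^sub>0 + t *\<^sub>R \<nu>, z + (norm (x\<^sub>0 + t *\<^sub>R \<nu>))\<^sup>2 / 2)
          + (1 / 2) *\<^sub>R (x\<^sub>0 + (- t) *\<^sub>R \<nu>, r + (- t) * m) \<in> E"
        using \<open>convex E\<close> by (intro convexD) auto
      moreover have "(1 / 2) *\<^sub>R (x\<^sub>0 + t *\<^sub>R \<nu>) + (1 / 2) *\<^sub>R (x\<^sub>0 + (- t) *\<^sub>R \<nu>) = x\<^sub>0"
        by (simp flip: scaleR_add_right scaleR_2)
      ultimately have "(x\<^sub>0, (z + (norm (x\<^sub>0 + t *\<^sub>R \<nu>))\<^sup>2 / 2 + (r - t * m)) / 2) \<in> E"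
        by (simp add: add_divide_distrib)
      from lowest[OF this] show "ereal (h t) \<le> ereal z"
        by (simp add: h_def)
    qed
  qed
  moreover have "(h has_real_derivative m - inner x\<^sub>0 \<nu> - t) (at t)" for t
    unfolding h_eq by (auto intro!: derivative_eq_intros)
  moreover have "((\<lambda>t. m - inner x\<^sub>0 \<nu> - t) has_real_derivative -1) (at t)" for t
    by (auto intro!: derivative_eq_intros)
  ultimately show ?thesis
    using \<open>norm \<nu> = 1\<close> \<open>t0 > 0\<close>
    by (intro disjI2 exI[of _ \<nu>] exI[of _ t0] exI[of _ h] exI[of _ "\<lambda>t. m - inner x\<^sub>0 \<nu> - t"])
      (auto simp: abs_less_iff)
qed simp

end
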